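(* Let $(Q,\cdot,\backslash,/)$ be a middle Bol loop with identity $e$, and let $f_1,g_1:Q^2\to Q$ and $\alpha_i,\beta_i:Q^i\to Q$ ($i\in\mathbb{N}$) be defined by $$f_1(x,y)=(yx)\backslash x\ \text{ or }\ f_1(x,y)=x\backslash(y\backslash x),\qquad g_1(x,y)=(xy)\backslash x\ \text{ or }\ g_1(x,y)=x\backslash(x/y),$$ $$\alpha_i(x_1,\ldots,x_i)=(\ldots(((x_1x_2)x_3)x_4)\ldots x_{i-1})x_i,$$ $$\beta_i(x_1,\ldots,x_i)=x_1\backslash(x_2\backslash(x_3\backslash(\cdots x_{i-2}\backslash(x_{i-1}\backslash x_i)\cdots))).$$ The following are true, where identities are for all $x,y\in Q$ and $n\in\mathbb{N}$, $n\ge 1$. 1. $f_1\big(x,\alpha_n(y,x,x,\ldots,x)\big)=\beta_n\big(x,x,\ldots,x,f_1(x,y)\big)$. 2. $f_1\big(x,\alpha_{n+1}(x,y,x,x,\ldots,x)\big)=\beta_{n+1}\big(x,x,x,\ldots,x,g_1(x,y)\big)$. 3. $(Q,\cdot)$ has the right alternative property (RAP) if and only if $f_1(x,y)=x[(yx^2)\backslash x]$ for all $x,y$. 4. $(Q,\cdot)$ has the power right alternative property (PRAP) if and only if $(yx^n)\cdot\beta_n\big(x,x,\ldots,x,f_1(x,y)\big)=x$ for all $x,y$ and all $n$. 5. If $(Q,\cdot)$ has the RAP, then $(Q,\cdot)$ is of exponent $2$ if and only if $f_1(x,y)=x(y\backslash x)$ for all $x,y$. 6. If $(Q,\cdot)$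 has the PRAP, then $(Q,\cdot)$ is of exponent $n$ if and only if $y\cdot\beta_n\big(x,x,\ldots,x,f_1(x,y)\big)=x$ for all $x,y$.
   Context: A loop $(Q,\cdot,\backslash,/)$ is a loop $(Q,\cdot)$ with identity $e$, where $x\backslash y$ is the unique $z$ with $x\cdot z=y$ and $x/y$ is the unique $z$ with $z\cdot y=x$. It is a middle Bol loop if $x((yz)\backslash x)=(x/z)(y\backslash x)$ for all $x,y,z$. Middle Bol loops are power associative (every element generates a subgroup), so powers $x^n$ are well defined. In a middle Bol loop the two expressions given for each of $f_1$ and $g_1$ agree. Conventions: $\alpha_1(x_1)=\beta_1(x_1)=x_1$; $\alpha_n$ and $\beta_n$ take exactly $n$ arguments (so e.g. $\alpha_n(y,x,\ldots,x)$ has $n-1$ entries $x$, and $\beta_n(x,\ldots,x,w)$ has $n-1$ entries $x$). RAP: $(yx)x=y(xx)$ for all $x,y$. PRAP: $(\cdots((yx)x)\cdots)x=yx^n$ ($n$ factors $x$ on the left-hand side) for all $x,y$ and all $n$. Exponent $n$: $x^n=e$ for all $x\in Q$. *)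

theory Defs
  imports "HOL-Algebra.Group"
begin

text \<open>
  Loops are carried by the monoid record of HOL-Algebra (its operations carry no axioms by
  themselves). The two divisions are determined by the multiplication, so they are defined from it
  rather than stored in the structure.
\<close>

locale loop =
  fixes Q :: "('a, 'b) monoid_scheme" (structure)
  assumes m_closed: "\<lbrakk>x \<in> carrier Q; y \<in> carrier Q\<rbrakk> \<Longrightarrow> x \<otimes> y \<in> carrier Q"
    and one_closed: "\<one> \<in> carrier Q"
    and l_one: "x \<in> carrier Q \<Longrightarrow> \<one> \<otimes> x = x"
    and r_one: "x \<in> carrier Q \<Longrightarrow> x \<otimes> \<one> = x"
    and ldiv_unique: "\<lbrakk>x \<in> carrier Q; y \<in> carrier Q\<rbrakk> \<Longrightarrow> \<exists>!z. z \<in> carrier Q \<and> x \<otimes> z = y"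
    and rdiv_unique: "\<lbrakk>x \<in> carrier Q; y \<in> carrier Q\<rbrakk> \<Longrightarrow> \<exists>!z. z \<in> carrier Q \<and> z \<otimes> y = x"

definition ldiv :: "('a, 'b) monoid_scheme \<Rightarrow> 'a \<Rightarrow> 'a \<Rightarrow> 'a" (infixl "\<setminus>\<index>" 70)
  where "x \<setminus>\<^bsub>Q\<^esub> y = (THE z. z \<in> carrier Q \<and> x \<otimes>\<^bsub>Q\<^esub> z = y)"

definition rdiv :: "('a, 'b) monoid_scheme \<Rightarrow> 'a \<Rightarrow> 'a \<Rightarrow> 'a" (infixl "\<oslash>\<index>" 70)
  where "x \<oslash>\<^bsub>Q\<^esub> y = (THE z. z \<in> carrier Q \<and> z \<otimes>\<^bsub>Q\<^esub> y = x)"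

locale middle_bol_loop = loop +
  assumes middle_bol: "\<lbrakk>x \<in> carrier Q; y \<in> carrier Q; z \<in> carrier Q\<rbrakk>
    \<Longrightarrow> x \<otimes> ((y \<otimes> z) \<setminus> x) = (x \<oslash> z) \<otimes> (y \<setminus> x)"

text \<open>
  The maps \<open>\<alpha>\<^sub>i\<close> and \<open>\<beta>\<^sub>i\<close> take their \<open>i\<close> arguments as a list of length \<open>i\<close>;
  only nonempty lists are meaningful.
\<close>

fun alpha :: "('a, 'b) monoid_scheme \<Rightarrow> 'a list \<Rightarrow> 'a" where
  "alpha Q (x # xs) = foldl (\<lambda>u v. u \<otimes>\<^bsub>Q\<^esub> v) x xs"

fun beta :: "('a, 'b) monoid_scheme \<Rightarrow> 'a list \<Rightarrow> 'a" where
  "beta Q [x] = x"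
| "beta Q (x # y # ys) = x \<setminus>\<^bsub>Q\<^esub> beta Q (y # ys)"

definition RAP :: "('a, 'b) monoid_scheme \<Rightarrow> bool" where
  "RAP Q \<longleftrightarrow> (\<forall>x\<in>carrier Q. \<forall>y\<in>carrier Q.
     (y \<otimes>\<^bsub>Q\<^esub> x) \<otimes>\<^bsub>Q\<^esub> x = y \<otimes>\<^bsub>Q\<^esub> (x \<otimes>\<^bsub>Q\<^esub> x))"

text \<open>
  Here and below \<open>x [^] n\<close> is the left-normed power \<open>(\<cdots>((\<one> \<otimes> x) \<otimes> x)\<cdots>) \<otimes> x\<close>. Middle Bol loops
  are power associative, so the bracketing chosen for \<open>x\<^sup>n\<close> is immaterial.
\<close>

definition PRAP :: "('a, 'b) monoid_scheme \<Rightarrow> bool" where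
  "PRAP Q \<longleftrightarrow> (\<forall>n::nat. 1 \<le> n \<longrightarrow> (\<forall>x\<in>carrier Q. \<forall>y\<in>carrier Q.
     foldl (\<lambda>u v. u \<otimes>\<^bsub>Q\<^esub> v) y (replicate n x) = y \<otimes>\<^bsub>Q\<^esub> (x [^]\<^bsub>Q\<^esub> n)))"

text \<open>No minimality of \<open>n\<close> is required.\<close>

definition of_exponent :: "('a, 'b) monoid_scheme \<Rightarrow> nat \<Rightarrow> bool" where
  "of_exponent Q n \<longleftrightarrow> (\<forall>x\<in>carrier Q. x [^]\<^bsub>Q\<^esub> n = \<one>\<^bsub>Q\<^esub>)"

end

theory Submission
  imports Defs
begin

text \<open>
  Setting \<open>z = x\<close> in the middle Bol identity gives \<open>(yx)\<setminus>x = x\<setminus>(y\<setminus>x)\<close>, and setting \<open>y = x\<close>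
  gives \<open>(xz)\<setminus>x = x\<setminus>(x/z)\<close>; so the two expressions for \<open>f\<^sub>1\<close>, and those for \<open>g\<^sub>1\<close>, agree.

  The first equation says more: the bijection \<open>y \<mapsto> y\<setminus>x\<close> turns right multiplication by \<open>x\<close> into left
  division by \<open>x\<close>. Iterating it, \<open>n - 1\<close> left divisions of \<open>f\<^sub>1(x,y) = (yx)\<setminus>x\<close> by \<open>x\<close> amount to
  \<open>((\<cdots>(yx)\<cdots>)x)\<setminus>x\<close> with \<open>n\<close> factors \<open>x\<close> (lemma \<open>beta_replicate_ldiv\<close>). This gives the two
  identities for \<open>f\<^sub>1\<close>, the second one on replacing \<open>y\<close> by \<open>xy\<close>.

  Each of the remaining equivalences compares two elements \<open>u\<close>, \<open>v\<close> through their quotients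
  \<open>u\<setminus>x\<close>, \<open>v\<setminus>x\<close>, from which they can be recovered (lemma \<open>ldiv_right_cancel\<close>). For RAP they are
  \<open>(yx)x\<close> and \<open>yx\<^sup>2\<close>; for PRAP they are \<open>(\<cdots>(yx)\<cdots>)x\<close> and \<open>yx\<^sup>n\<close>; for exponent \<open>n\<close> they are \<open>yx\<^sup>n\<close>
  and \<open>y\<close>, whose equality means \<open>x\<^sup>n = e\<close> by left cancellation.
\<close>

context loop
begin

lemma ldiv_props:
  assumes "x \<in> carrier Q" "y \<in> carrier Q"
  shows ldiv_closed: "x \<setminus> y \<in> carrier Q" and mult_ldiv: "x \<otimes> (x \<setminus> y) = y"
  using theI'[OF ldiv_unique[OF assms]] unfolding ldiv_def by auto

lemma mult_left_cancel:
  assumes "x \<in> carrier Q" "y \<in> carrier Q" "z \<in> carrier Q"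
  shows "x \<otimes> y = x \<otimes> z \<longleftrightarrow> y = z"
  using ldiv_unique[of x "x \<otimes> y"] assms m_closed by metis

lemma mult_right_cancel:
  assumes "x \<in> carrier Q" "y \<in> carrier Q" "z \<in> carrier Q"
  shows "y \<otimes> x = z \<otimes> x \<longleftrightarrow> y = z"
  using rdiv_unique[of "y \<otimes> x" x] assms m_closed by metis

lemma ldiv_eqI:
  assumes "x \<in> carrier Q" "z \<in> carrier Q" "x \<otimes> z = y"
  shows "x \<setminus> y = z"
  using assms mult_left_cancel ldiv_props m_closed by metis

lemma rdiv_self:
  assumes "x \<in> carrier Q"
  shows "x \<oslash> x = \<one>"
  unfolding rdiv_def
  using assms one_closed l_one rdiv_unique[of x x] by (intro the1_equality) auto

lemma ldiv_self:
  assumes "x \<in> carrier Q"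
  shows "x \<setminus> x = \<one>"
  using assms one_closed r_one by (intro ldiv_eqI) auto

lemma rdiv_closed:
  assumes "x \<in> carrier Q" "y \<in> carrier Q"
  shows "x \<oslash> y \<in> carrier Q"
  using theI'[OF rdiv_unique[OF assms]] unfolding rdiv_def by auto

lemma mult_ldiv_eq_iff:
  assumes "u \<in> carrier Q" "v \<in> carrier Q" "x \<in> carrier Q"
  shows "u \<otimes> (v \<setminus> x) = x \<longleftrightarrow> v = u"
  using assms mult_right_cancel[of "v \<setminus> x" u v] ldiv_props by metis

lemma ldiv_right_cancel:
  assumes "u \<in> carrier Q" "v \<in> carrier Q" "x \<in> carrier Q"
  shows "u \<setminus> x = v \<setminus> x \<longleftrightarrow> u = v"
  using assms mult_ldiv_eq_iff mult_ldiv by metis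

lemma mult_eq_self_iff:
  assumes "y \<in> carrier Q" "u \<in> carrier Q"
  shows "y \<otimes> u = y \<longleftrightarrow> u = \<one>"
  using assms mult_left_cancel[of y u \<one>] one_closed r_one by metis

lemma foldl_mult_closed:
  assumes "y \<in> carrier Q" "set xs \<subseteq> carrier Q"
  shows "foldl (\<otimes>) y xs \<in> carrier Q"
  using assms by (induction xs arbitrary: y) (auto intro: m_closed)

lemma nat_pow_closed:
  assumes "x \<in> carrier Q"
  shows "x [^] (n::nat) \<in> carrier Q"
  using assms by (induction n) (auto intro: m_closed one_closed)

lemma nat_pow_two:
  assumes "x \<in> carrier Q"
  shows "x [^] (2::nat) = x \<otimes> x"
  using assms l_one by (simp add: numeral_2_eq_2)

lemma of_exponent_iff_mult_pow:
  "of_exponent Q n \<longleftrightarrow> (\<forall>x\<in>carrier Q. \<forall>y\<in>carrier Q. y \<otimes> (x [^] n) = y)"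
  unfolding of_exponent_def using mult_eq_self_iff nat_pow_closed one_closed by blast

end

lemma beta_Cons:
  assumes "xs \<noteq> []"
  shows "beta Q (x # xs) = x \<setminus>\<^bsub>Q\<^esub> beta Q xs"
  using assms by (cases xs) auto

context middle_bol_loop
begin

text \<open>This is the middle Bol identity at \<open>z = x\<close>, where \<open>x/z\<close> is the identity element.\<close>

lemma mult_right_ldiv:
  assumes x: "x \<in> carrier Q" and y: "y \<in> carrier Q"
  shows "(y \<otimes> x) \<setminus> x = x \<setminus> (y \<setminus> x)"
proof -
  have "x \<otimes> ((y \<otimes> x) \<setminus> x) = y \<setminus> x"
    using middle_bol[OF x y x] rdiv_self l_one ldiv_closed x y by simp
  then show ?thesis
    using ldiv_eqI m_closed ldiv_closed x y by metis
qed

text \<open>This is the middle Bol identity at \<open>y = x\<close>, where \<open>y\<setminus>x\<close> is the identity element.\<close>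

lemma mult_left_ldiv:
  assumes x: "x \<in> carrier Q" and z: "z \<in> carrier Q"
  shows "(x \<otimes> z) \<setminus> x = x \<setminus> (x \<oslash> z)"
proof -
  have "x \<otimes> ((x \<otimes> z) \<setminus> x) = x \<oslash> z"
    using middle_bol[OF x x z] ldiv_self r_one rdiv_closed x z by simp
  then show ?thesis
    using ldiv_eqI m_closed ldiv_closed x z by metis
qed

text \<open>
  Each further left division by \<open>x\<close> is absorbed into the divisor as a right factor \<open>x\<close>, by
  \<open>mult_right_ldiv\<close> read from right to left.
\<close>

lemma beta_replicate_ldiv:
  assumes x: "x \<in> carrier Q" and y: "y \<in> carrier Q"
  shows "beta Q (replicate k x @ [y \<setminus> x]) = foldl (\<otimes>) y (replicate k x) \<setminus> x"
proof (induction k)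
  case (Suc k)
  have "foldl (\<otimes>) y (replicate k x) \<in> carrier Q"
    using x y by (intro foldl_mult_closed) auto
  then have "x \<setminus> (foldl (\<otimes>) y (replicate k x) \<setminus> x) = foldl (\<otimes>) y (replicate k x @ [x]) \<setminus> x"
    using mult_right_ldiv x by simp
  then show ?case
    using Suc by (simp add: beta_Cons replicate_append_same)
qed simp

text \<open>
  The last left division before the outer factor \<open>x\<close> is undone by it, so the right-hand side of the
  RAP criterion with \<open>(yx)x\<close> in place of \<open>yx\<^sup>2\<close> always equals \<open>f\<^sub>1(x,y)\<close>.
\<close>

lemma mult_ldiv_mult_mult:
  assumes "x \<in> carrier Q" "y \<in> carrier Q"
  shows "x \<otimes> (((y \<otimes> x) \<otimes> x) \<setminus> x) = (y \<otimes> x) \<setminus> x"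
  using assms mult_right_ldiv[of x "y \<otimes> x"] mult_ldiv ldiv_closed m_closed by simp

lemma RAP_iff_ldiv:
  "RAP Q \<longleftrightarrow> (\<forall>x\<in>carrier Q. \<forall>y\<in>carrier Q.
     (y \<otimes> x) \<setminus> x = x \<otimes> ((y \<otimes> (x [^] (2::nat))) \<setminus> x))"
proof -
  have "(y \<otimes> x) \<setminus> x = x \<otimes> ((y \<otimes> (x [^] (2::nat))) \<setminus> x) \<longleftrightarrow> (y \<otimes> x) \<otimes> x = y \<otimes> (x \<otimes> x)"
    if "x \<in> carrier Q" "y \<in> carrier Q" for x y
    using that mult_ldiv_mult_mult[OF that, symmetric]
    by (simp add: nat_pow_two mult_left_cancel ldiv_right_cancel ldiv_closed m_closed)
  then show ?thesis
    unfolding RAP_def by blast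
qed

text \<open>
  Under RAP, \<open>f\<^sub>1(x,y) = x((yx\<^sup>2)\<setminus>x)\<close>, and this is \<open>x(y\<setminus>x)\<close> exactly when \<open>yx\<^sup>2 = y\<close>.
\<close>

lemma RAP_exponent_two_iff:
  assumes "RAP Q"
  shows "of_exponent Q 2 \<longleftrightarrow>
    (\<forall>x\<in>carrier Q. \<forall>y\<in>carrier Q. (y \<otimes> x) \<setminus> x = x \<otimes> (y \<setminus> x))"
proof -
  have "(y \<otimes> x) \<setminus> x = x \<otimes> (y \<setminus> x) \<longleftrightarrow> y \<otimes> (x [^] (2::nat)) = y"
    if "x \<in> carrier Q" "y \<in> carrier Q" for x y
    using that assms
    by (simp add: RAP_iff_ldiv mult_left_cancel ldiv_right_cancel ldiv_closed m_closed
        nat_pow_closed)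
  then show ?thesis
    unfolding of_exponent_iff_mult_pow by blast
qed

end

theorem theorem2p1:
  fixes Q :: "('a, 'b) monoid_scheme" (structure)
    and f1 g1 :: "'a \<Rightarrow> 'a \<Rightarrow> 'a"
  assumes "middle_bol_loop Q"
    and f1: "(\<forall>x\<in>carrier Q. \<forall>y\<in>carrier Q. f1 x y = (y \<otimes> x) \<setminus> x) \<or>
             (\<forall>x\<in>carrier Q. \<forall>y\<in>carrier Q. f1 x y = x \<setminus> (y \<setminus> x))"
    and g1: "(\<forall>x\<in>carrier Q. \<forall>y\<in>carrier Q. g1 x y = (x \<otimes> y) \<setminus> x) \<or>
             (\<forall>x\<in>carrier Q. \<forall>y\<in>carrier Q. g1 x y = x \<setminus> (x \<oslash> y))"
  shows "(\<forall>n::nat. 1 \<le> n \<longrightarrow> (\<forall>x\<in>carrier Q. \<forall>y\<in>carrier Q.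
           f1 x (alpha Q (y # replicate (n - 1) x)) = beta Q (replicate (n - 1) x @ [f1 x y])))
    \<and> (\<forall>n::nat. 1 \<le> n \<longrightarrow> (\<forall>x\<in>carrier Q. \<forall>y\<in>carrier Q.
           f1 x (alpha Q (x # y # replicate (n - 1) x)) = beta Q (replicate n x @ [g1 x y])))
    \<and> (RAP Q \<longleftrightarrow> (\<forall>x\<in>carrier Q. \<forall>y\<in>carrier Q.
           f1 x y = x \<otimes> ((y \<otimes> (x [^] (2::nat))) \<setminus> x)))
    \<and> (PRAP Q \<longleftrightarrow> (\<forall>n::nat. 1 \<le> n \<longrightarrow> (\<forall>x\<in>carrier Q. \<forall>y\<in>carrier Q.
           (y \<otimes> (x [^] n)) \<otimes> beta Q (replicate (n - 1) x @ [f1 x y]) = x)))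
    \<and> (RAP Q \<longrightarrow> (of_exponent Q 2 \<longleftrightarrow> (\<forall>x\<in>carrier Q. \<forall>y\<in>carrier Q.
           f1 x y = x \<otimes> (y \<setminus> x))))
    \<and> (PRAP Q \<longrightarrow> (\<forall>n::nat. 1 \<le> n \<longrightarrow> (of_exponent Q n \<longleftrightarrow>
           (\<forall>x\<in>carrier Q. \<forall>y\<in>carrier Q.
             y \<otimes> beta Q (replicate (n - 1) x @ [f1 x y]) = x))))"
proof -
  interpret middle_bol_loop Q by fact
  have f1_eq: "f1 x y = (y \<otimes> x) \<setminus> x" if "x \<in> carrier Q" "y \<in> carrier Q" for x y
    using f1 that mult_right_ldiv by auto
  have g1_eq: "g1 x y = (x \<otimes> y) \<setminus> x" if "x \<in> carrier Q" "y \<in> carrier Q" for x y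
    using g1 that mult_left_ldiv by auto
  have fold_closed: "foldl (\<otimes>) y (replicate k x) \<in> carrier Q"
    if "x \<in> carrier Q" "y \<in> carrier Q" for x y and k :: nat
    using that by (intro foldl_mult_closed) auto

  \<comment> \<open>The factor \<open>x\<close> hidden in \<open>f1 x y\<close> makes up for the missing one in \<open>replicate (n - 1) x\<close>.\<close>
  have beta_f1: "beta Q (replicate (n - 1) x @ [f1 x y]) = foldl (\<otimes>) y (replicate n x) \<setminus> x"
    if "1 \<le> n" "x \<in> carrier Q" "y \<in> carrier Q" for n :: nat and x y
    using that beta_replicate_ldiv[of x "y \<otimes> x" "n - 1"]
    by (cases n) (simp_all add: f1_eq m_closed)

  have f1_alpha:
    "f1 x (alpha Q (y # replicate (n - 1) x)) = beta Q (replicate (n - 1) x @ [f1 x y])"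
    if "1 \<le> n" "x \<in> carrier Q" "y \<in> carrier Q" for n :: nat and x y
  proof -
    have "foldl (\<otimes>) y (replicate (n - 1) x) \<otimes> x = foldl (\<otimes>) y (replicate (n - 1) x @ [x])"
      by simp
    also have "replicate (n - 1) x @ [x] = replicate n x"
      using that(1) by (cases n) (simp_all add: replicate_append_same)
    finally show ?thesis
      using that unfolding beta_f1[OF that] by (simp add: f1_eq fold_closed)
  qed
  have f1_alpha_mult:
    "f1 x (alpha Q (x # y # replicate (n - 1) x)) = beta Q (replicate n x @ [g1 x y])"
    if "1 \<le> n" "x \<in> carrier Q" "y \<in> carrier Q" for n :: nat and x y
  proof -
    have "foldl (\<otimes>) (x \<otimes> y) (replicate (n - 1) x) \<otimes> x
        = foldl (\<otimes>) (x \<otimes> y) (replicate (n - 1) x @ [x])"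
      by simp
    also have "replicate (n - 1) x @ [x] = replicate n x"
      using that(1) by (cases n) (simp_all add: replicate_append_same)
    finally show ?thesis
      using that by (simp add: f1_eq g1_eq beta_replicate_ldiv fold_closed m_closed)
  qed
  have RAP_iff: "RAP Q \<longleftrightarrow> (\<forall>x\<in>carrier Q. \<forall>y\<in>carrier Q.
      f1 x y = x \<otimes> ((y \<otimes> (x [^] (2::nat))) \<setminus> x))"
    unfolding RAP_iff_ldiv using f1_eq by auto
  have PRAP_iff: "PRAP Q \<longleftrightarrow> (\<forall>n::nat. 1 \<le> n \<longrightarrow> (\<forall>x\<in>carrier Q. \<forall>y\<in>carrier Q.
      (y \<otimes> (x [^] n)) \<otimes> beta Q (replicate (n - 1) x @ [f1 x y]) = x))"
  proof -
    have "(y \<otimes> (x [^] n)) \<otimes> beta Q (replicate (n - 1) x @ [f1 x y]) = x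
        \<longleftrightarrow> foldl (\<otimes>) y (replicate n x) = y \<otimes> (x [^] n)"
      if "1 \<le> n" "x \<in> carrier Q" "y \<in> carrier Q" for n :: nat and x y
      unfolding beta_f1[OF that]
      using that by (intro mult_ldiv_eq_iff fold_closed m_closed nat_pow_closed)
    then show ?thesis
      unfolding PRAP_def by blast
  qed
  have exponent_two_iff:
    "of_exponent Q 2 \<longleftrightarrow> (\<forall>x\<in>carrier Q. \<forall>y\<in>carrier Q. f1 x y = x \<otimes> (y \<setminus> x))"
    if "RAP Q"
    using RAP_exponent_two_iff[OF that] f1_eq by auto
  have exponent_iff: "of_exponent Q n \<longleftrightarrow> (\<forall>x\<in>carrier Q. \<forall>y\<in>carrier Q.
      y \<otimes> beta Q (replicate (n - 1) x @ [f1 x y]) = x)"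
    if "PRAP Q" "1 \<le> n" for n :: nat
  proof -
    have "y \<otimes> beta Q (replicate (n - 1) x @ [f1 x y]) = x \<longleftrightarrow> y \<otimes> (x [^] n) = y"
      if "x \<in> carrier Q" "y \<in> carrier Q" for x y
    proof -
      have "foldl (\<otimes>) y (replicate n x) = y \<otimes> (x [^] n)"
        using \<open>PRAP Q\<close> \<open>1 \<le> n\<close> that unfolding PRAP_def by blast
      then have "beta Q (replicate (n - 1) x @ [f1 x y]) = (y \<otimes> (x [^] n)) \<setminus> x"
        using beta_f1[OF \<open>1 \<le> n\<close> that] by simp
      then show ?thesis
        using that by (simp add: mult_ldiv_eq_iff m_closed nat_pow_closed)
    qed
    then show ?thesis
      unfolding of_exponent_iff_mult_pow by blast
  qed
  show ?thesis
    by (intro conjI allI ballI impI;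
        (rule f1_alpha f1_alpha_mult RAP_iff PRAP_iff exponent_two_iff exponent_iff; assumption))
qed

end
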